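(* Let $p$ be a prime, let $k \geq 1$ be an integer with $p \geq 2k+2$, and let $n$ be a non-negative integer with $n \leq p^2-1$. Suppose that the monomial $x^n$ is $k$-PN over $\mathbb{F}_{p^2}$. Then, writing $n = a + bp$ in base $p$ (with integers $0 \leq a,b \leq p-1$), we have $a + b = k+1$.
   Context: $\mathbb{F}_q$ denotes the finite field with $q$ elements. For a polynomial $f \in \mathbb{F}_q[x]$ and $a_1,\dots,a_k \in \mathbb{F}_q$, the $k$-th finite difference of $f$ in directions $(a_1,\dots,a_k)$ is defined recursively by $\nabla_{a}^1 f = f(x+a)-f(x)$ and $\nabla_{a_1,\dots,a_k}^k f = g(x+a_k)-g(x)$, where $g(x) = \nabla_{a_1,\dots,a_{k-1}}^{k-1} f$. The polynomial $f$ is called $k$-PN over $\mathbb{F}_q$ if, for every choice of $(a_1,\dots,a_k)$ with all $a_i \in \mathbb{F}_q$ and $a_i \neq 0$, the function $\mathbb{F}_q \to \mathbb{F}_q$ associated to $\nabla_{a_1,\dots,a_k}^k f$ is a bijection. *)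

theory Defs
  imports
    "HOL-Computational_Algebra.Polynomial"
    "HOL-Computational_Algebra.Primes"
    "HOL-Library.Cardinality"
begin

text \<open>
  The difference is taken at the level of polynomials: \<open>f \<circ>\<^sub>p [:a, 1:]\<close> is \<open>f(x + a)\<close>.
\<close>

definition poly_diff :: "'a::comm_ring_1 \<Rightarrow> 'a poly \<Rightarrow> 'a poly" where
  "poly_diff a f = f \<circ>\<^sub>p [:a, 1:] - f"

text \<open>
  The directions are given by a sequence \<open>a\<close>, of which only \<open>a 1, \<dots>, a k\<close> are used,
  \<open>a 1\<close> being applied first.
\<close>

primrec poly_diffs :: "nat \<Rightarrow> (nat \<Rightarrow> 'a::comm_ring_1) \<Rightarrow> 'a poly \<Rightarrow> 'a poly" where
  "poly_diffs 0 a f = f"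
| "poly_diffs (Suc k) a f = poly_diff (a (Suc k)) (poly_diffs k a f)"

text \<open>
  The finite field is the whole type \<open>'a\<close>; its number of elements is \<open>CARD('a)\<close>.
\<close>

definition k_PN :: "nat \<Rightarrow> 'a::{field,finite} poly \<Rightarrow> bool" where
  "k_PN k f \<longleftrightarrow>
     (\<forall>a :: nat \<Rightarrow> 'a. (\<forall>i\<in>{1..k}. a i \<noteq> 0) \<longrightarrow> bij (poly (poly_diffs k a f)))"

end

theory Submission
  imports Defs
begin

text \<open>
  On the prime field \<open>\<int>/p\<close> the monomial \<open>x ^ n\<close> agrees with \<open>x ^ e\<close>, where \<open>e < p\<close> and
  \<open>e \<equiv> a + b\<close> modulo \<open>p - 1\<close>. Its difference of order \<open>k - 1\<close> is a planar function on
  \<open>\<int>/p\<close> of degree \<open>e - k + 1\<close>, and planar functions on a prime field are quadratic: if \<open>g\<close>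
  is planar, then so is \<open>g + c x\<close> for every \<open>c\<close>, whence
  all moments \<open>\<Sum>x. g x ^ i * x ^ l\<close> with \<open>2 * (i + l) < p - 1\<close> vanish, which forces
  \<open>degree g \<le> 2\<close>. So \<open>e = k + 1\<close>, and \<open>a + b\<close> is \<open>k + 1\<close> or \<open>p + k\<close>.

  If \<open>a + b = p + k\<close>, let \<open>D\<close> be the \<open>k\<close>-th difference of \<open>f x = x ^ n\<close> with all directions
  equal to 1. As \<open>D\<close> is a bijection, \<open>\<Sum>x. D x * D x ^ p = 0\<close>. Up to sign this sum is the
  \<open>2 k\<close>-th central difference at 0 of \<open>t \<mapsto> (\<Sum>x. f x * f (x + t) ^ p)\<close>, which on
  \<open>\<int>/p\<close> is \<open>c * t ^ (2 * k + 2)\<close> with \<open>c = - (b choose k + 1) * (a choose k + 1) \<noteq> 0\<close>. The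
  \<open>2 k\<close>-th central difference of \<open>t ^ (2 * k + 2)\<close> at 0 is \<open>k * fact (2 * k + 2) / 12\<close>,
  which is not divisible by \<open>p\<close>: a contradiction.
\<close>

subsection \<open>Power sums over a finite subfield\<close>

lemma of_nat_choose_neq_0:
  assumes "prime CHAR('a::field)" "m < CHAR('a)" "i \<le> m"
  shows "of_nat (m choose i) \<noteq> (0::'a)"
proof
  assume "of_nat (m choose i) = (0::'a)"
  then have "CHAR('a) dvd (m choose i)"
    by (simp only: of_nat_eq_0_iff_char_dvd)
  then have "CHAR('a) dvd fact m"
    using binomial_fact_lemma[OF assms(3)] by (metis dvd_mult)
  then show False
    using assms by (simp add: prime_dvd_fact_iff)
qed

text \<open>For a finite set these closure conditions already give a subfield. The locale is applied
  to the whole field and to its prime field.\<close>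

locale finite_subfield =
  fixes K :: "'a::field set"
  assumes finite_K: "finite K"
    and one_K: "1 \<in> K"
    and diff_K: "x \<in> K \<Longrightarrow> y \<in> K \<Longrightarrow> x - y \<in> K"
    and mult_K: "x \<in> K \<Longrightarrow> y \<in> K \<Longrightarrow> x * y \<in> K"
begin

lemma zero_K: "0 \<in> K"
  using diff_K[OF one_K one_K] by simp

lemma add_K: "x \<in> K \<Longrightarrow> y \<in> K \<Longrightarrow> x + y \<in> K"
  using diff_K[of x "0 - y"] diff_K[OF zero_K, of y] by simp

lemma power_K: "x \<in> K \<Longrightarrow> x ^ n \<in> K"
  by (induction n) (auto intro: one_K mult_K)

lemma card_K_ge_2: "card K \<ge> 2"
  using card_mono[OF finite_K, of "{0, 1}"] zero_K one_K by simp

lemma bij_betw_add: "t \<in> K \<Longrightarrow> bij_betw (\<lambda>x. x + t) K K"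
  by (rule bij_betw_byWitness[where f' = "\<lambda>x. x - t"]) (auto intro: add_K diff_K)

lemma bij_betw_mult:
  assumes "y \<in> K" "y \<noteq> 0"
  shows "bij_betw (\<lambda>x. y * x) (K - {0}) (K - {0})"
  unfolding bij_betw_def
proof
  show inj: "inj_on (\<lambda>x. y * x) (K - {0})"
    using assms by (auto simp: inj_on_def)
  show "(\<lambda>x. y * x) ` (K - {0}) = K - {0}"
    by (rule endo_inj_surj) (use assms inj finite_K mult_K in auto)
qed

lemma power_card_minus_1:
  assumes "y \<in> K" "y \<noteq> 0"
  shows "y ^ (card K - 1) = 1"
proof -
  have "prod id (K - {0}) = (\<Prod>x\<in>K-{0}. y * x)"
    using prod.reindex_bij_betw[OF bij_betw_mult[OF assms], of id] by simp
  also have "\<dots> = y ^ (card K - 1) * prod id (K - {0})"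
    using finite_K zero_K by (simp add: prod.distrib)
  finally show ?thesis
    using finite_K by auto
qed

lemma power_card:
  assumes "y \<in> K"
  shows "y ^ card K = y"
proof -
  have "card K = Suc (card K - 1)"
    using card_K_ge_2 by simp
  then have "y ^ card K = y * y ^ (card K - 1)"
    by (metis power_Suc)
  then show ?thesis
    using power_card_minus_1[OF assms] by (cases "y = 0") auto
qed

lemma of_nat_card: "of_nat (card K) = (0::'a)"
proof -
  have "sum id K = (\<Sum>x\<in>K. x + 1)"
    using sum.reindex_bij_betw[OF bij_betw_add[OF one_K], of id] by simp
  then show ?thesis
    by (simp add: sum.distrib)
qed

text \<open>Reduction of \<open>j\<close> modulo \<open>card K - 1\<close> leaves
  \<open>0 < r < card K - 1\<close>, and \<open>x ^ r - 1\<close> has too few roots to vanish at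
  every nonzero element.\<close>

lemma exists_power_neq_1:
  assumes "\<not> (card K - 1) dvd j"
  obtains y where "y \<in> K" "y \<noteq> 0" "y ^ j \<noteq> 1"
proof -
  define r where "r = j mod (card K - 1)"
  have r: "0 < r" "r < card K - 1"
    using assms card_K_ge_2 by (auto simp: r_def dvd_eq_mod_eq_0)
  define f :: "'a poly" where "f = monom 1 r - 1"
  have cf: "coeff f r = 1"
    using r by (simp add: f_def)
  then have f0: "f \<noteq> 0"
    by auto
  have "degree f \<le> r"
    unfolding f_def by (rule degree_diff_le) (auto simp: degree_monom_eq)
  then have "card {x. poly f x = 0} < card K - 1"
    using card_poly_roots_bound[OF f0] r by simp
  then have "\<not> K - {0} \<subseteq> {x. poly f x = 0}"
    using card_mono[OF poly_roots_finite[OF f0], of "K - {0}"] finite_K zero_K by auto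
  then obtain y where y: "y \<in> K" "y \<noteq> 0" "y ^ r \<noteq> 1"
    by (auto simp: f_def poly_monom)
  have "y ^ j = y ^ ((card K - 1) * (j div (card K - 1)) + r)"
    by (simp add: r_def)
  also have "\<dots> = y ^ r"
    using power_card_minus_1[OF y(1,2)] by (simp add: power_add power_mult)
  finally show ?thesis
    using that y by auto
qed

text \<open>Replacing \<open>x\<close> by \<open>y * x\<close> multiplies the sum by
  \<open>y ^ j\<close>, which differs from 1 for a suitable \<open>y\<close>.\<close>

lemma power_sum_eq_0:
  assumes "\<not> (card K - 1) dvd j"
  shows "(\<Sum>x\<in>K. x ^ j) = 0"
proof -
  obtain y where y: "y \<in> K" "y \<noteq> 0" "y ^ j \<noteq> 1"
    using exists_power_neq_1[OF assms] .
  have j: "j \<noteq> 0"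
    using assms by (metis dvd_0_right)
  then have nz: "(\<Sum>x\<in>K. x ^ j) = (\<Sum>x\<in>K-{0}. x ^ j)"
    by (intro sum.mono_neutral_right) (use finite_K in auto)
  also have "\<dots> = (\<Sum>x\<in>K-{0}. (y * x) ^ j)"
    using sum.reindex_bij_betw[OF bij_betw_mult[OF y(1,2)], of "\<lambda>x. x ^ j"] by simp
  also have "\<dots> = y ^ j * (\<Sum>x\<in>K-{0}. x ^ j)"
    by (simp add: power_mult_distrib sum_distrib_left)
  finally show ?thesis
    using y(3) nz by auto
qed

lemma power_sum_card_minus_1: "(\<Sum>x\<in>K. x ^ (card K - 1)) = -1"
proof -
  have "(\<Sum>x\<in>K. x ^ (card K - 1)) = (\<Sum>x\<in>K-{0}. x ^ (card K - 1))"
    by (intro sum.mono_neutral_right) (use finite_K card_K_ge_2 in \<open>auto simp: power_0_left\<close>)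
  also have "\<dots> = (\<Sum>x\<in>K-{0}. 1)"
    by (intro sum.cong) (auto simp: power_card_minus_1[simplified])
  also have "\<dots> = of_nat (card K - 1)"
    using finite_K zero_K by simp
  also have "\<dots> = - 1"
    using of_nat_card card_K_ge_2 by (simp add: of_nat_diff)
  finally show ?thesis .
qed

lemma power_sum_less: "j < card K - 1 \<Longrightarrow> (\<Sum>x\<in>K. x ^ j) = 0"
  using power_sum_eq_0[of j] of_nat_card nat_dvd_not_less[of j "card K - 1"]
  by (cases "j = 0") auto

text \<open>Only the top monomial survives the summation, so a polynomial of degree exactly
  \<open>card K - 1\<close> has nonzero sum.\<close>

lemma sum_poly:
  assumes "degree f \<le> card K - 1"
  shows "(\<Sum>x\<in>K. poly f x) = - coeff f (card K - 1)"
proof -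
  let ?n = "card K - 1"
  have "(\<Sum>x\<in>K. poly f x) = (\<Sum>x\<in>K. \<Sum>i\<le>?n. coeff f i * x ^ i)"
    using poly_as_sum_of_monoms'[OF assms] by (metis (no_types, lifting) poly_sum poly_monom sum.cong)
  also have "\<dots> = (\<Sum>i\<le>?n. coeff f i * (\<Sum>x\<in>K. x ^ i))"
    by (subst sum.swap) (simp add: sum_distrib_left)
  also have "\<dots> = (\<Sum>i\<in>{?n}. coeff f i * (\<Sum>x\<in>K. x ^ i))"
    by (intro sum.mono_neutral_right) (auto simp: power_sum_less[simplified])
  finally show ?thesis
    using power_sum_card_minus_1 by simp
qed

text \<open>The easy half of Hermite's criterion: a bijection merely reorders a vanishing power
  sum.\<close>

lemma bij_power_sum:
  assumes "bij_betw f K K" "j < card K - 1"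
  shows "(\<Sum>x\<in>K. f x ^ j) = 0"
  using sum.reindex_bij_betw[OF assms(1), of "\<lambda>x. x ^ j"] power_sum_less[OF assms(2)] by simp

end

subsection \<open>Planar functions on a prime field\<close>

context finite_subfield
begin

definition planar_on :: "('a \<Rightarrow> 'a) \<Rightarrow> bool" where
  "planar_on G \<longleftrightarrow> (\<forall>\<alpha>\<in>K - {0}. bij_betw (\<lambda>x. G (x + \<alpha>) - G x) K K)"

text \<open>The linear term shifts the difference in direction \<alpha> by the constant
  \<open>c * \<alpha>\<close>.\<close>

lemma planar_on_add_linear:
  assumes "planar_on G" "c \<in> K"
  shows "planar_on (\<lambda>x. G x + c * x)"
  unfolding planar_on_def
proof
  fix \<alpha> assume \<alpha>: "\<alpha> \<in> K - {0}"
  have "bij_betw ((\<lambda>x. x + c * \<alpha>) \<circ> (\<lambda>x. G (x + \<alpha>) - G x)) K K"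
    by (rule bij_betw_trans[OF _ bij_betw_add])
      (use assms \<alpha> mult_K in \<open>auto simp: planar_on_def\<close>)
  also have "(\<lambda>x. x + c * \<alpha>) \<circ> (\<lambda>x. G (x + \<alpha>) - G x)
      = (\<lambda>x. G (x + \<alpha>) + c * (x + \<alpha>) - (G x + c * x))"
    by (auto simp: algebra_simps)
  finally show "bij_betw \<dots> K K" .
qed

text \<open>The sum of \<open>(G x - G y) ^ (2 * j)\<close> over all pairs vanishes, and all its terms but the
  middle one of the binomial expansion vanish by induction.\<close>

lemma planar_on_power_sum:
  assumes G: "planar_on G" and char: "CHAR('a) = card K" and "prime (card K)"
    and "2 * j < card K - 1"
  shows "(\<Sum>x\<in>K. G x ^ j) = 0"
  using assms(4)
proof (induction j rule: less_induct)
  case (less j)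
  let ?S = "\<lambda>i. \<Sum>x\<in>K. G x ^ i"
  show ?case
  proof (cases "j = 0")
    case True
    then show ?thesis using of_nat_card by simp
  next
    case False
    \<comment> \<open>Regroup the pairs by their difference \<alpha> = x - y.\<close>
    have "(\<Sum>y\<in>K. \<Sum>x\<in>K. (G x - G y) ^ (2 * j))
        = (\<Sum>y\<in>K. \<Sum>\<alpha>\<in>K. (G (y + \<alpha>) - G y) ^ (2 * j))"
    proof (rule sum.cong[OF refl])
      fix y assume y: "y \<in> K"
      show "(\<Sum>x\<in>K. (G x - G y) ^ (2 * j)) = (\<Sum>\<alpha>\<in>K. (G (y + \<alpha>) - G y) ^ (2 * j))"
        using sum.reindex_bij_betw[OF bij_betw_add[OF y], of "\<lambda>x. (G x - G y) ^ (2 * j)"]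
        by (simp add: add.commute)
    qed
    also have "\<dots> = (\<Sum>\<alpha>\<in>K. \<Sum>y\<in>K. (G (y + \<alpha>) - G y) ^ (2 * j))"
      by (rule sum.swap)
    also have "\<dots> = 0"
    proof (rule sum.neutral, rule)
      fix \<alpha> assume "\<alpha> \<in> K"
      then show "(\<Sum>y\<in>K. (G (y + \<alpha>) - G y) ^ (2 * j)) = 0"
        using G bij_power_sum[of "\<lambda>y. G (y + \<alpha>) - G y" "2 * j"] less.prems False
        by (cases "\<alpha> = 0") (auto simp: planar_on_def power_0_left)
    qed
    finally have "0 = (\<Sum>y\<in>K. \<Sum>x\<in>K. (G x - G y) ^ (2 * j))" ..
    also have "\<dots> = (\<Sum>y\<in>K. \<Sum>x\<in>K. \<Sum>i\<le>2*j. of_nat (2 * j choose i) * G x ^ i * (- G y) ^ (2 * j - i))"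
      by (simp only: diff_conv_add_uminus binomial_ring)
    also have "\<dots> = (\<Sum>y\<in>K. \<Sum>i\<le>2*j. \<Sum>x\<in>K. of_nat (2 * j choose i) * G x ^ i * (- G y) ^ (2 * j - i))"
      by (intro sum.cong[OF refl] sum.swap)
    also have "\<dots> = (\<Sum>i\<le>2*j. \<Sum>y\<in>K. \<Sum>x\<in>K. of_nat (2 * j choose i) * G x ^ i * (- G y) ^ (2 * j - i))"
      by (rule sum.swap)
    also have "\<dots> = (\<Sum>i\<le>2*j. of_nat (2 * j choose i) * (-1) ^ (2 * j - i) * (?S i * ?S (2 * j - i)))"
    proof (rule sum.cong[OF refl])
      fix i
      have "(\<Sum>y\<in>K. \<Sum>x\<in>K. of_nat (2 * j choose i) * G x ^ i * (- G y) ^ (2 * j - i))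
        = (\<Sum>y\<in>K. \<Sum>x\<in>K. of_nat (2 * j choose i) * (-1) ^ (2 * j - i) * (G x ^ i * G y ^ (2 * j - i)))"
        by (intro sum.cong[OF refl]) (subst power_minus, simp add: algebra_simps)
      also have "\<dots> = of_nat (2 * j choose i) * (-1) ^ (2 * j - i) * (\<Sum>y\<in>K. \<Sum>x\<in>K. G x ^ i * G y ^ (2 * j - i))"
        by (simp add: sum_distrib_left)
      also have "(\<Sum>y\<in>K. \<Sum>x\<in>K. G x ^ i * G y ^ (2 * j - i)) = ?S i * ?S (2 * j - i)"
        by (subst sum.swap) (simp add: sum_product)
      finally show "(\<Sum>y\<in>K. \<Sum>x\<in>K. of_nat (2 * j choose i) * G x ^ i * (- G y) ^ (2 * j - i))
        = of_nat (2 * j choose i) * (-1) ^ (2 * j - i) * (?S i * ?S (2 * j - i))" .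
    qed
    also have "\<dots> = (\<Sum>i\<in>{j}. of_nat (2 * j choose i) * (-1) ^ (2 * j - i) * (?S i * ?S (2 * j - i)))"
    proof (rule sum.mono_neutral_right; (rule ballI)?)
      fix i assume "i \<in> {..2 * j} - {j}"
      then have "i < j \<or> 2 * j - i < j"
        by auto
      then have "?S i = 0 \<or> ?S (2 * j - i) = 0"
        using less.IH less.prems by fastforce
      then show "of_nat (2 * j choose i) * (-1) ^ (2 * j - i) * (?S i * ?S (2 * j - i)) = 0"
        by auto
    qed auto
    finally have "of_nat (2 * j choose j) * (?S j * ?S j) = 0"
      by simp
    moreover have "of_nat (2 * j choose j) \<noteq> (0::'a)"
      using of_nat_choose_neq_0[where 'a='a, of "2 * j" j] assms(2,3) less.prems by simp
    ultimately show ?thesis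
      by simp
  qed
qed

end

subsection \<open>Degrees of differences\<close>

lemma poly_poly_diff [simp]: "poly (poly_diff \<alpha> f) x = poly f (x + \<alpha>) - poly f x"
  by (simp add: poly_diff_def poly_pcompose add.commute)

lemma poly_diff_pCons:
  "poly_diff \<alpha> (pCons c h) = pCons 0 (poly_diff \<alpha> h) + smult \<alpha> (h + poly_diff \<alpha> h)"
  by (simp add: poly_diff_def pcompose_pCons smult_add_right smult_diff_right algebra_simps)

text \<open>An upper bound on the degree, unlike equality, passes on to the tail \<open>h\<close> in
  the induction. The coefficient is that of \<alpha> times the derivative.\<close>

lemma coeff_poly_diff_aux:
  fixes f :: "'a::comm_ring_1 poly"
  shows "degree f \<le> Suc m \<Longrightarrow> degree (poly_diff \<alpha> f) \<le> m \<and>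
    coeff (poly_diff \<alpha> f) m = of_nat (Suc m) * \<alpha> * coeff f (Suc m)"
proof (induction f arbitrary: m)
  case 0
  then show ?case
    by (simp add: poly_diff_def)
next
  case (pCons c h)
  have dh: "degree h \<le> m"
    using pCons.prems pCons.hyps by (cases "h = 0") auto
  show ?case
  proof (cases m)
    case 0
    then obtain d where h: "h = [:d:]"
      using dh degree_eq_zeroE by (metis le_zero_eq)
    then show ?thesis
      unfolding poly_diff_pCons using 0 by (simp add: poly_diff_def)
  next
    case (Suc m')
    note IH = pCons.IH[of m', folded Suc, OF dh]
    have "degree (poly_diff \<alpha> h) < m"
      using IH Suc by auto
    then have z: "coeff (poly_diff \<alpha> h) m = 0"
      by (rule coeff_eq_0)
    have "degree (pCons 0 (poly_diff \<alpha> h)) \<le> m"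
      using IH Suc by (auto simp: degree_pCons_eq_if)
    moreover have "degree (h + poly_diff \<alpha> h) \<le> m"
      using dh IH Suc by (intro degree_add_le) auto
    ultimately have "degree (poly_diff \<alpha> (pCons c h)) \<le> m"
      unfolding poly_diff_pCons
      by (intro degree_add_le) (auto intro: order_trans[OF degree_smult_le])
    then show ?thesis
      using IH Suc z by (simp add: poly_diff_pCons algebra_simps)
  qed
qed

text \<open>Below the characteristic the new leading coefficient, \<open>degree f\<close> times
  \<alpha> times the old one, is nonzero. For constants, truncated subtraction makes both sides
  0.\<close>

lemma degree_poly_diff:
  fixes f :: "'a::idom poly"
  assumes "degree f < CHAR('a)" "\<alpha> \<noteq> 0"
  shows "degree (poly_diff \<alpha> f) = degree f - 1"
proof (cases "degree f")
  case 0
  then obtain c where "f = [:c:]"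
    using degree_eq_zeroE by blast
  then show ?thesis
    by (simp add: poly_diff_def)
next
  case (Suc m)
  have "of_nat (Suc m) \<noteq> (0::'a)"
    using assms Suc nat_dvd_not_less[of "Suc m" "CHAR('a)"]
    by (simp only: of_nat_eq_0_iff_char_dvd) auto
  moreover have "coeff f (Suc m) \<noteq> 0"
    using Suc by (metis leading_coeff_0_iff degree_0 nat.distinct(1))
  ultimately have "coeff (poly_diff \<alpha> f) m \<noteq> 0"
    using coeff_poly_diff_aux[of f m \<alpha>] Suc assms by simp
  then have "m \<le> degree (poly_diff \<alpha> f)"
    by (rule le_degree)
  then show ?thesis
    using coeff_poly_diff_aux[of f m \<alpha>] Suc by simp
qed

lemma degree_poly_diffs:
  fixes f :: "'a::idom poly"
  assumes "degree f < CHAR('a)" "\<And>i. i \<in> {1..k} \<Longrightarrow> v i \<noteq> 0"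
  shows "degree (poly_diffs k v f) = degree f - k"
  using assms(2) by (induction k) (use assms(1) in \<open>auto simp: degree_poly_diff\<close>)

lemma poly_diffs_cong:
  "(\<And>i. i \<in> {1..k} \<Longrightarrow> v i = w i) \<Longrightarrow> poly_diffs k v f = poly_diffs k w f"
  by (induction k) auto

subsection \<open>Planar polynomials on a prime field are quadratic\<close>

text \<open>With \<open>p - 1 = e * i + l\<close> the claim reads \<open>l + 2 * i < e * i\<close>.
  Equality holds for \<open>p = 9\<close>, \<open>e = 3\<close>, and also for
  \<open>2 * e = p + 1\<close>, where \<open>i = 1\<close> and \<open>l = e - 2\<close>.\<close>

lemma quotient_plus_remainder_bound:
  fixes p e :: nat
  assumes "odd p" "p \<noteq> 9" "3 \<le> e" "e < p" "2 * e \<noteq> p + 1"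
  shows "2 * ((p - 1) div e + (p - 1) mod e) < p - 1"
proof -
  define i l where "i = (p - 1) div e" and "l = (p - 1) mod e"
  have eq: "p - 1 = e * i + l"
    by (simp add: i_def l_def)
  have l: "l < e"
    using assms by (simp add: l_def)
  have i0: "i \<noteq> 0"
    using assms by (simp add: i_def div_eq_0_iff)
  have "l + 2 * i < e * i"
  proof -
    consider "i = 1" | "i \<ge> 2" "e \<ge> 4" | "i = 2" "e = 3" | "i \<ge> 3" "e = 3"
      using i0 assms by linarith
    then show ?thesis
    proof cases
      case 1
      have "p = e + l + 1"
        using eq 1 assms by simp
      \<comment> \<open>\<open>l = e - 1\<close> would give the even value \<open>p = 2 * e\<close>,
        and \<open>l = e - 2\<close> would give \<open>2 * e = p + 1\<close>.\<close>
      moreover have "l + 1 \<noteq> e" "l + 2 \<noteq> e"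
        using assms calculation by (auto elim: oddE)
      ultimately show ?thesis
        using 1 l by simp
    next
      case 2
      have "2 * (e - 2) \<le> i * (e - 2)"
        using 2 by simp
      then have "2 * e - 4 \<le> i * e - i * 2"
        by (simp add: algebra_simps)
      then show ?thesis
        using 2 l by (simp add: mult.commute)
    next
      case 3
      then have "l \<noteq> 2"
        using eq assms by auto
      then show ?thesis
        using 3 l by simp
    next
      case 4
      then show ?thesis
        using l by simp
    qed
  qed
  then have "2 * (i + l) < p - 1"
    unfolding eq by simp
  then show ?thesis
    by (simp only: i_def l_def)
qed

context finite_subfield
begin

text \<open>The sum over \<open>x\<close> of \<open>(G x + c * x) ^ (i + l)\<close> vanishes for
  every \<open>c\<close> in \<open>K\<close>. As a polynomial in \<open>c\<close> its degree is
  below \<open>card K\<close>, so it is zero; its coefficient at \<open>c ^ l\<close> is a nonzero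
  binomial coefficient times the moment.\<close>

lemma planar_on_moment:
  assumes G: "planar_on G" and char: "CHAR('a) = card K" and "prime (card K)"
    and j: "2 * (i + l) < card K - 1"
  shows "(\<Sum>x\<in>K. G x ^ i * x ^ l) = 0"
proof -
  let ?j = "i + l"
  define T where "T r = of_nat (?j choose r) * (\<Sum>x\<in>K. G x ^ (?j - r) * x ^ r)" for r
  define h where "h = (\<Sum>r\<le>?j. monom (T r) r)"
  have "poly h c = 0" if c: "c \<in> K" for c
  proof -
    have "poly h c = (\<Sum>r\<le>?j. \<Sum>x\<in>K. of_nat (?j choose r) * (c * x) ^ r * G x ^ (?j - r))"
      by (simp add: h_def T_def poly_sum poly_monom sum_distrib_left sum_distrib_right
          power_mult_distrib ac_simps)
    also have "\<dots> = (\<Sum>x\<in>K. (c * x + G x) ^ ?j)"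
      by (subst sum.swap) (simp only: binomial_ring)
    also have "\<dots> = 0"
      using planar_on_power_sum[OF planar_on_add_linear[OF G c] char \<open>prime (card K)\<close> j]
      by (simp add: add.commute)
    finally show ?thesis .
  qed
  then have "K \<subseteq> {c. poly h c = 0}"
    by auto
  moreover have "degree h \<le> ?j"
    unfolding h_def by (rule degree_sum_le) (auto intro: order_trans[OF degree_monom_le])
  ultimately have "h = 0"
    using card_poly_roots_bound[of h] card_mono[OF poly_roots_finite[of h], of K] j by fastforce
  then have "coeff h l = 0"
    by simp
  then have "T l = 0"
    by (simp add: h_def coeff_sum)
  moreover have "of_nat (?j choose l) \<noteq> (0::'a)"
    using of_nat_choose_neq_0[where 'a='a, of ?j l] char \<open>prime (card K)\<close> j by simp
  ultimately show ?thesis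
    by (simp add: T_def)
qed

text \<open>If \<open>e = degree g\<close> and \<open>card K - 1 = e * i + l\<close>, then \<open>g ^ i * x ^ l\<close> has degree
  \<open>card K - 1\<close>, so that its sum over \<open>K\<close> is nonzero. This contradicts
  the vanishing moments except for \<open>e = (card K + 1) / 2\<close>, where the square of a first difference
  has degree \<open>card K - 1\<close>.\<close>

lemma planar_on_degree_le_2:
  assumes G: "planar_on (poly g)" and char: "CHAR('a) = card K" and prime: "prime (card K)"
    and deg: "degree g < card K"
  shows "degree g \<le> 2"
proof (rule ccontr)
  define e where "e = degree g"
  assume "\<not> degree g \<le> 2"
  then have e: "3 \<le> e" "e < card K"
    using deg by (auto simp: e_def)
  have odd: "odd (card K)"
    using prime e by (auto simp: prime_odd_nat)
  have g0: "g \<noteq> 0"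
    using e by (auto simp: e_def)
  show False
  proof (cases "2 * e = card K + 1")
    case True
    define D where "D = poly_diff 1 g"
    have dD: "degree D = e - 1"
      unfolding D_def e_def by (rule degree_poly_diff) (use deg char in auto)
    then have D0: "D \<noteq> 0"
      using e by auto
    have dD2: "degree (D ^ 2) = card K - 1"
      using dD True D0 by (simp add: degree_power_eq)
    have "(\<Sum>x\<in>K. poly (D ^ 2) x) = - coeff (D ^ 2) (card K - 1)"
      by (rule sum_poly) (simp add: dD2)
    moreover have "(\<Sum>x\<in>K. poly (D ^ 2) x) = 0"
      using bij_power_sum[of "\<lambda>x. poly g (x + 1) - poly g x" 2] G one_K e True
      by (simp add: planar_on_def D_def)
    moreover have "coeff (D ^ 2) (card K - 1) \<noteq> 0"
      using D0 by (metis dD2 leading_coeff_0_iff power_not_zero)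
    ultimately show False
      by simp
  next
    case False
    define i l where "i = (card K - 1) div e" and "l = (card K - 1) mod e"
    have "card K \<noteq> 9"
      using prime prime_product[of 3 3] by auto
    then have "2 * (i + l) < card K - 1"
      unfolding i_def l_def using quotient_plus_remainder_bound[OF odd _ e False] by simp
    then have "(\<Sum>x\<in>K. poly (g ^ i * monom 1 l) x) = 0"
      using planar_on_moment[OF G char prime] by (simp add: poly_monom)
    moreover have dh: "degree (g ^ i * monom 1 l) = card K - 1"
      using g0 by (subst degree_mult_eq)
        (auto simp: degree_power_eq degree_monom_eq e_def[symmetric] i_def l_def mult.commute)
    then have "(\<Sum>x\<in>K. poly (g ^ i * monom 1 l) x) = - coeff (g ^ i * monom 1 l) (card K - 1)"
      by (intro sum_poly) simp
    moreover have "coeff (g ^ i * monom 1 l) (card K - 1) \<noteq> 0"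
      unfolding dh[symmetric] leading_coeff_0_iff using g0 by simp
    ultimately show False
      by simp
  qed
qed

end

text \<open>Shifts by elements of \<open>K\<close> never leave \<open>K\<close>, so \<open>f\<close>
  may be replaced by a polynomial of lower degree inducing the same function on
  \<open>K\<close>.\<close>

lemma (in finite_subfield) poly_diffs_on_K:
  assumes "\<And>x. x \<in> K \<Longrightarrow> poly f x = poly h x" "\<And>x. x \<in> K \<Longrightarrow> poly h x \<in> K"
    and "\<And>i. i \<in> {1..k} \<Longrightarrow> v i \<in> K"
    and "x \<in> K"
  shows "poly (poly_diffs k v f) x = poly (poly_diffs k v h) x"
    and "poly (poly_diffs k v h) x \<in> K"
proof -
  have "\<forall>x\<in>K. poly (poly_diffs k v f) x = poly (poly_diffs k v h) x
      \<and> poly (poly_diffs k v h) x \<in> K"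
    using assms(3)
  proof (induction k)
    case 0
    then show ?case using assms by simp
  next
    case (Suc k)
    have v: "v (Suc k) \<in> K"
      using Suc.prems by simp
    have IH: "\<forall>x\<in>K. poly (poly_diffs k v f) x = poly (poly_diffs k v h) x
        \<and> poly (poly_diffs k v h) x \<in> K"
      by (rule Suc.IH) (use Suc.prems in auto)
    show ?case
      using IH add_K[OF _ v] by (simp add: diff_K)
  qed
  then show "poly (poly_diffs k v f) x = poly (poly_diffs k v h) x"
    and "poly (poly_diffs k v h) x \<in> K"
    using assms(4) by auto
qed

text \<open>Taking \<open>k - 1\<close> unit differences of \<open>h\<close> gives a planar
  \<open>g\<close> of degree \<open>degree h - (k - 1)\<close>, and this degree must be exactly
  2.\<close>

lemma k_PN_degree_on_subfield:
  fixes K :: "'a::{field,finite} set"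
  assumes "finite_subfield K" and char: "CHAR('a) = card K" and prime: "prime (card K)"
    and PN: "k_PN k f" and k: "k \<ge> 1"
    and agree: "\<And>x. x \<in> K \<Longrightarrow> poly f x = poly h x" "\<And>x. x \<in> K \<Longrightarrow> poly h x \<in> K"
    and deg: "degree h < card K"
  shows "degree h = k + 1"
proof -
  interpret finite_subfield K by fact
  obtain k' where k': "k = Suc k'"
    using k by (cases k) auto
  define g where "g = poly_diffs k' (\<lambda>_. 1) h"
  have dg: "degree g = degree h - k'"
    unfolding g_def by (rule degree_poly_diffs) (use deg char in auto)
  have planar: "planar_on (poly g)"
    unfolding planar_on_def
  proof
    fix \<alpha> assume \<alpha>: "\<alpha> \<in> K - {0}"
    define v where "v i = (if i = k then \<alpha> else 1)" for i
    have "poly_diffs k' v h = g"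
      unfolding g_def by (rule poly_diffs_cong) (auto simp: v_def k')
    then have eq: "poly g (x + \<alpha>) - poly g x = poly (poly_diffs k v h) x" for x
      by (simp add: k' v_def)
    have v: "v i \<in> K" "v i \<noteq> 0" for i
      using \<alpha> one_K by (auto simp: v_def)
    note on_K = poly_diffs_on_K[of f h k v, OF agree v(1)]
    have "bij (poly (poly_diffs k v f))"
      using PN v(2) by (auto simp: k_PN_def)
    \<comment> \<open>Injectivity on the whole field restricts to \<open>K\<close>; surjectivity
      onto \<open>K\<close> then follows from finiteness, as the values stay in
      \<open>K\<close>.\<close>
    then have inj: "inj_on (poly (poly_diffs k v h)) K"
      by (metis (no_types, lifting) inj_onI bij_is_inj injD on_K(1))
    moreover have "poly (poly_diffs k v h) ` K = K"
      by (rule endo_inj_surj[OF finite_K _ inj]) (use on_K(2) in auto)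
    ultimately show "bij_betw (\<lambda>x. poly g (x + \<alpha>) - poly g x) K K"
      by (simp add: eq bij_betw_def)
  qed
  \<comment> \<open>In degree at most 1 the unit difference would be constant, hence not injective
    on \<open>K\<close>.\<close>
  have "degree g \<noteq> 0 \<and> degree g \<noteq> 1"
  proof (rule ccontr)
    assume "\<not> ?thesis"
    then have "degree (poly_diff 1 g) = 0"
      using degree_poly_diff[of g 1] dg deg char by auto
    then obtain c where c: "poly_diff 1 g = [:c:]"
      using degree_eq_zeroE by blast
    have "poly g (x + 1) - poly g x = c" for x
      using arg_cong[OF c, of "\<lambda>f. poly f x"] by simp
    then show False
      using planar one_K zero_K unfolding planar_on_def bij_betw_def inj_on_def
      by (metis DiffI singletonD zero_neq_one)
  qed
  moreover have "degree g \<le> 2"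
    by (rule planar_on_degree_le_2[OF planar char prime]) (use dg deg in auto)
  ultimately show ?thesis
    using dg k' by linarith
qed

subsection \<open>The prime subfield\<close>

lemma prime_CHAR_finite: "prime CHAR('a::{field,finite})"
  by (rule prime_CHAR_semidom) (rule finite_imp_CHAR_pos[OF finite])

lemma finite_subfield_UNIV: "finite_subfield (UNIV :: 'a::{field,finite} set)"
  by standard auto

lemma finite_subfield_range_of_int: "finite_subfield (range of_int :: 'a::{field,finite} set)"
proof
  fix x y :: 'a assume "x \<in> range of_int" "y \<in> range of_int"
  then obtain i j where xy: "x = of_int i" "y = of_int j"
    by (elim rangeE)
  show "x - y \<in> range of_int"
    by (rule range_eqI[of _ _ "i - j"]) (simp add: xy)
  show "x * y \<in> range of_int"
    by (rule range_eqI[of _ _ "i * j"]) (simp add: xy)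
next
  show "(1::'a) \<in> range of_int"
    by (rule range_eqI[of _ _ 1]) simp
qed simp

lemma card_range_of_int: "card (range of_int :: 'a::{field,finite} set) = CHAR('a)"
proof -
  let ?p = "CHAR('a)"
  have p: "?p > 0"
    using prime_CHAR_finite by (rule prime_gt_0_nat)
  have inj: "inj_on (of_nat :: nat \<Rightarrow> 'a) {..<?p}"
  proof (rule linorder_inj_onI)
    fix m n assume "m < n" "m \<in> {..<?p}" "n \<in> {..<?p}"
    then show "of_nat m \<noteq> (of_nat n :: 'a)"
      using nat_dvd_not_less[of "n - m" ?p] by (auto simp: of_nat_eq_iff_char_dvd)
  qed auto
  have "range of_int = (of_nat :: nat \<Rightarrow> 'a) ` {..<?p}"
  proof (intro equalityI subsetI)
    fix x :: 'a assume "x \<in> range of_int"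
    then obtain z where z: "x = of_int z"
      by blast
    have "of_int (z - z mod int ?p) = (0 :: 'a)"
      unfolding of_int_eq_0_iff_char_dvd by (rule dvd_minus_mod)
    then have "x = of_nat (nat (z mod int ?p))"
      using z p by simp
    moreover have "nat (z mod int ?p) < ?p"
      using p by (simp add: nat_less_iff)
    ultimately show "x \<in> of_nat ` {..<?p}"
      by blast
  next
    fix x :: 'a assume "x \<in> of_nat ` {..<?p}"
    then show "x \<in> range of_int"
      by (metis imageE of_int_of_nat_eq rangeI)
  qed
  then show ?thesis
    using card_image[OF inj] by simp
qed

lemma CHAR_eq_of_CARD:
  assumes "prime p" "CARD('a::{field,finite}) = p ^ m"
  shows "CHAR('a) = p"
proof -
  interpret finite_subfield "UNIV :: 'a set"
    by (rule finite_subfield_UNIV)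
  have "CHAR('a) dvd p ^ m"
    using of_nat_card assms(2) by (simp only: of_nat_eq_0_iff_char_dvd)
  then have "CHAR('a) dvd p"
    using prime_CHAR_finite prime_dvd_power by blast
  then show ?thesis
    using assms(1) prime_CHAR_finite primes_dvd_imp_eq by blast
qed

lemma diff_power_CHAR:
  fixes x y :: "'a::{field,finite}"
  shows "(x - y) ^ CHAR('a) = x ^ CHAR('a) - y ^ CHAR('a)"
  using freshmans_dream[OF prime_CHAR_finite refl, of "x - y" y] by simp

subsection \<open>Central differences of powers\<close>

text \<open>The second central difference, so that \<open>cdiff ^^ k\<close> is the central
  difference of order \<open>2 * k\<close>. Integer arguments allow its evaluation over
  \<open>int\<close> before passing to the field.\<close>

definition cdiff :: "(int \<Rightarrow> 'b::ab_group_add) \<Rightarrow> int \<Rightarrow> 'b" where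
  "cdiff h z = h (z + 1) - h z - h z + h (z - 1)"

lemma cdiff_funpow_scale_of_int:
  "(cdiff ^^ k) (\<lambda>z. c * of_int (h z)) = (\<lambda>z. c * of_int ((cdiff ^^ k) h z))"
proof (induction k)
  case (Suc k)
  have "cdiff (\<lambda>z. c * of_int (g z)) = (\<lambda>z. c * of_int (cdiff g z))" for g
    by (rule ext) (simp only: cdiff_def ring_distribs of_int_add of_int_diff)
  then show ?case
    by (simp add: Suc)
qed simp

lemma cdiff_funpow_sum:
  fixes c :: "'i \<Rightarrow> int"
  shows "(cdiff ^^ k) (\<lambda>z. \<Sum>i\<in>A. c i * h i z) = (\<lambda>z. \<Sum>i\<in>A. c i * (cdiff ^^ k) (h i) z)"
proof (induction k)
  case (Suc k)
  have "cdiff (\<lambda>z. \<Sum>i\<in>A. c i * g i z) = (\<lambda>z. \<Sum>i\<in>A. c i * cdiff (g i) z)" for g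
    by (rule ext) (simp only: cdiff_def ring_distribs sum.distrib sum_subtractf)
  then show ?case
    by (simp add: Suc)
qed simp

text \<open>In \<open>(z + 1) ^ m + (z - 1) ^ m\<close> the term \<open>i = 0\<close> cancels
  against \<open>- 2 * z ^ m\<close>, and the factor \<open>1 + (-1) ^ i\<close> removes odd
  \<open>i\<close>.\<close>

lemma cdiff_power:
  "cdiff (\<lambda>z. z ^ m) = (\<lambda>z::int. \<Sum>i=1..m. int (m choose i) * (1 + (-1) ^ i) * z ^ (m - i))"
proof
  fix z :: int
  have "(z + 1) ^ m = (\<Sum>i\<le>m. int (m choose i) * z ^ (m - i))"
    using binomial_ring[of 1 z m] by (simp add: add.commute)
  moreover have "(z - 1) ^ m = (\<Sum>i\<le>m. int (m choose i) * (-1) ^ i * z ^ (m - i))"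
    using binomial_ring[of "-1" z m] by (simp add: add.commute)
  ultimately have "(z + 1) ^ m + (z - 1) ^ m
      = (\<Sum>i\<le>m. int (m choose i) * (1 + (-1) ^ i) * z ^ (m - i))"
    by (simp add: sum.distrib algebra_simps)
  also have "\<dots> = 2 * z ^ m + (\<Sum>i=1..m. int (m choose i) * (1 + (-1) ^ i) * z ^ (m - i))"
    by (simp add: atMost_atLeast0 sum.atLeast_Suc_atMost)
  finally show "cdiff (\<lambda>z. z ^ m) z
      = (\<Sum>i=1..m. int (m choose i) * (1 + (-1) ^ i) * z ^ (m - i))"
    by (simp add: cdiff_def)
qed

text \<open>This is \<open>fact (2 * k)\<close> times the central factorial number T(m, 2k).\<close>

definition cdiff_power_at_0 :: "nat \<Rightarrow> nat \<Rightarrow> int" where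
  "cdiff_power_at_0 k m = (cdiff ^^ k) (\<lambda>z. z ^ m) 0"

lemma cdiff_power_at_0_0: "cdiff_power_at_0 0 m = 0 ^ m"
  by (simp add: cdiff_power_at_0_def)

lemma cdiff_power_at_0_Suc:
  "cdiff_power_at_0 (Suc k) m
    = (\<Sum>i=1..m. int (m choose i) * (1 + (-1) ^ i) * cdiff_power_at_0 k (m - i))"
  by (simp only: cdiff_power_at_0_def funpow_Suc_right o_apply cdiff_power cdiff_funpow_sum)

lemma cdiff_power_at_0_less: "m < 2 * k \<Longrightarrow> cdiff_power_at_0 k m = 0"
proof (induction k arbitrary: m)
  case (Suc k)
  show ?case
    unfolding cdiff_power_at_0_Suc
  proof (rule sum.neutral, rule)
    fix i assume "i \<in> {1..m}"
    then show "int (m choose i) * (1 + (-1) ^ i) * cdiff_power_at_0 k (m - i) = 0"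
      using Suc by (cases "i = 1") auto
  qed
qed simp

text \<open>Odd \<open>i\<close> carry the factor 0, and terms with \<open>m - i < 2 * k\<close>
  vanish; for \<open>m\<close> close to \<open>2 * k\<close> hardly any index is left.\<close>

lemma cdiff_power_at_0_Suc_restrict:
  assumes "I \<subseteq> {1..m}" "\<And>i. i \<in> {1..m} - I \<Longrightarrow> odd i \<or> m < 2 * k + i"
  shows "cdiff_power_at_0 (Suc k) m
    = (\<Sum>i\<in>I. int (m choose i) * (1 + (-1) ^ i) * cdiff_power_at_0 k (m - i))"
  unfolding cdiff_power_at_0_Suc
proof (rule sum.mono_neutral_right; (rule ballI)?)
  fix i assume i: "i \<in> {1..m} - I"
  then have "odd i \<or> m - i < 2 * k"
    using assms(2)[OF i] by auto
  then show "int (m choose i) * (1 + (-1) ^ i) * cdiff_power_at_0 k (m - i) = 0"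
    by (auto simp: cdiff_power_at_0_less)
qed (use assms in auto)

lemma fact_add_eq: "fact (m + r) = fact r * int (m + r choose r) * fact m"
proof -
  have "fact r * fact m * (m + r choose r) = fact (m + r)"
    using binomial_fact_lemma[of r "m + r"] by simp
  then have "int (fact r * fact m * (m + r choose r)) = int (fact (m + r))"
    by presburger
  then show ?thesis
    by (simp add: ac_simps)
qed

lemma fact_choose_2: "fact (m + 2) = 2 * int (m + 2 choose 2) * fact m"
  using fact_add_eq[of m 2] by simp

lemma fact_choose_4: "fact (m + 4) = 24 * int (m + 4 choose 4) * fact m"
  using fact_add_eq[of m 4] by (simp add: fact_numeral)

lemma cdiff_power_at_0_eq: "cdiff_power_at_0 k (2 * k) = fact (2 * k)"
proof (induction k)
  case (Suc k)
  have "cdiff_power_at_0 (Suc k) (2 * Suc k)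
      = (\<Sum>i\<in>{2}. int (2 * Suc k choose i) * (1 + (-1) ^ i) * cdiff_power_at_0 k (2 * Suc k - i))"
  proof (rule cdiff_power_at_0_Suc_restrict)
    fix i assume "i \<in> {1..2 * Suc k} - {2}"
    then have "i = 1 \<or> i > 2"
      by auto
    then show "odd i \<or> 2 * Suc k < 2 * k + i"
      by auto
  qed auto
  also have "\<dots> = fact (2 * Suc k)"
    using Suc fact_choose_2[of "2 * k"] by simp
  finally show ?case .
qed (simp add: cdiff_power_at_0_0)

text \<open>The recursion keeps \<open>i = 2\<close> and \<open>i = 4\<close>. After scaling by 12,
  which avoids fractions, they contribute \<open>k\<close> copies and one copy of
  \<open>fact (2 * k + 4)\<close>.\<close>

lemma cdiff_power_at_0_next:
  "12 * cdiff_power_at_0 k (2 * k + 2) = int k * fact (2 * k + 2)"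
proof (induction k)
  case (Suc k)
  have step: "2 * Suc k + 2 = 2 * k + 4"
    by simp
  have "cdiff_power_at_0 (Suc k) (2 * k + 4)
      = (\<Sum>i\<in>{2,4}. int (2 * k + 4 choose i) * (1 + (-1) ^ i) * cdiff_power_at_0 k (2 * k + 4 - i))"
  proof (rule cdiff_power_at_0_Suc_restrict)
    fix i assume i: "i \<in> {1..2 * k + 4} - {2,4}"
    then have "i = 1 \<or> i = 3 \<or> i > 4"
      by auto
    then show "odd i \<or> 2 * k + 4 < 2 * k + i"
      by auto
  qed auto
  then have "12 * cdiff_power_at_0 (Suc k) (2 * k + 4)
      = 2 * int (2 * k + 4 choose 2) * (12 * cdiff_power_at_0 k (2 * k + 2))
        + 24 * int (2 * k + 4 choose 4) * fact (2 * k)"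
    by (simp add: cdiff_power_at_0_eq)
  also have "\<dots> = int k * (2 * int (2 * k + 4 choose 2) * fact (2 * k + 2))
      + 24 * int (2 * k + 4 choose 4) * fact (2 * k)"
    unfolding Suc by (simp only: mult.left_commute)
  also have "2 * int (2 * k + 4 choose 2) * fact (2 * k + 2) = fact (2 * k + 4)"
    using fact_choose_2[of "2 * k + 2"] by (simp only: add.assoc) simp
  also have "24 * int (2 * k + 4 choose 4) * fact (2 * k) = fact (2 * k + 4)"
    by (rule fact_choose_4[symmetric])
  also have "int k * fact (2 * k + 4) + fact (2 * k + 4) = int (Suc k) * fact (2 * k + 4)"
    by (simp only: of_nat_Suc distrib_right mult_1_left add.commute)
  finally show ?case
    unfolding step .
qed (simp add: cdiff_power_at_0_0)

subsection \<open>The autocorrelation of the monomial\<close>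

definition unit_diff :: "('a::ring_1 \<Rightarrow> 'a) \<Rightarrow> 'a \<Rightarrow> 'a" where
  "unit_diff g x = g (x + 1) - g x"

lemma poly_poly_diffs_1: "poly (poly_diffs k (\<lambda>_. 1) f) = (unit_diff ^^ k) (poly f)"
  by (induction k) (auto simp: unit_diff_def fun_eq_iff)

lemma unit_diff_funpow_power_CHAR:
  fixes g :: "'a::{field,finite} \<Rightarrow> 'a"
  shows "(unit_diff ^^ k) (\<lambda>x. g x ^ CHAR('a)) = (\<lambda>x. (unit_diff ^^ k) g x ^ CHAR('a))"
  by (induction k) (auto simp: unit_diff_def fun_eq_iff diff_power_CHAR)

definition corr :: "('a::{field,finite} \<Rightarrow> 'a) \<Rightarrow> ('a \<Rightarrow> 'a) \<Rightarrow> 'a \<Rightarrow> 'a" where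
  "corr f g t = (\<Sum>x\<in>UNIV. f x * g (x + t))"

text \<open>Translating the summation variable turns the four products into correlations at
  \<open>t + 1\<close>, twice \<open>t\<close>, and \<open>t - 1\<close>.\<close>

lemma corr_unit_diff:
  "corr (unit_diff f) (unit_diff g) t = - (corr f g (t + 1) - corr f g t - corr f g t + corr f g (t - 1))"
proof -
  have shift: "(\<Sum>x\<in>UNIV. h (x + 1)) = (\<Sum>x\<in>UNIV. h x)" for h :: "'a \<Rightarrow> 'a"
    using sum.reindex_bij_betw[OF finite_subfield.bij_betw_add[OF finite_subfield_UNIV UNIV_I], of h 1]
    by simp
  have "corr (unit_diff f) (unit_diff g) t
      = (\<Sum>x\<in>UNIV. f (x + 1) * g (x + 1 + t)) - (\<Sum>x\<in>UNIV. f (x + 1) * g (x + 1 + (t - 1)))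
        - (\<Sum>x\<in>UNIV. f x * g (x + (t + 1))) + (\<Sum>x\<in>UNIV. f x * g (x + t))"
    by (simp add: corr_def unit_diff_def algebra_simps sum.distrib sum_subtractf)
  then show ?thesis
    unfolding shift[of "\<lambda>x. f x * g (x + t)"] shift[of "\<lambda>x. f x * g (x + (t - 1))"]
    by (simp add: corr_def)
qed

lemma corr_unit_diff_funpow:
  "corr ((unit_diff ^^ k) f) ((unit_diff ^^ k) g) (of_int z)
    = (-1) ^ k * (cdiff ^^ k) (\<lambda>z. corr f g (of_int z)) z"
proof (induction k arbitrary: z)
  case (Suc k)
  have "corr ((unit_diff ^^ Suc k) f) ((unit_diff ^^ Suc k) g) (of_int z)
      = - cdiff (\<lambda>z. corr ((unit_diff ^^ k) f) ((unit_diff ^^ k) g) (of_int z)) z"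
    by (simp add: corr_unit_diff cdiff_def)
  then show ?case
    by (simp add: Suc cdiff_def algebra_simps)
qed simp

lemma of_int_power_CHAR: "(of_int z :: 'a::{field,finite}) ^ CHAR('a) = of_int z"
  using finite_subfield.power_card[OF finite_subfield_range_of_int, of "of_int z :: 'a"]
  by (simp add: card_range_of_int)

text \<open>The second possible digit sum, \<open>p + k\<close>, which is to be refuted. The
  parameter \<open>F\<close> carries the field type.\<close>

locale large_digit_sum =
  fixes F :: "'a::{field,finite} itself" and p k a b n :: nat
  assumes prime_p: "prime p" and k: "k \<ge> 1" and p: "p \<ge> 2 * k + 2"
    and CARD: "CARD('a) = p ^ 2"
    and ab: "a < p" "b < p" "a + b = p + k" and n: "n = a + b * p"
begin

lemma CHAR_p: "CHAR('a) = p"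
  using CHAR_eq_of_CARD[OF prime_p CARD] .

lemma k_bound: "2 * k + 3 \<le> p"
proof -
  have "p \<noteq> 2 * k + 2"
    using prime_p k prime_odd_nat[of p] by auto
  then show ?thesis
    using p by simp
qed

lemma frobenius_twice: "(x::'a) ^ (p * p) = x"
  using finite_subfield.power_card[OF finite_subfield_UNIV UNIV_I, of x] CARD
  by (simp add: power2_eq_square)

lemma power_n: "(x::'a) ^ n = x ^ a * (x ^ p) ^ b"
  by (simp add: n power_add power_mult mult.commute[of b])

lemma of_int_power_n: "(of_int z :: 'a) ^ n = of_int z ^ (k + 1)"
proof -
  have "(of_int z :: 'a) ^ n = of_int z ^ (a + b)"
    using of_int_power_CHAR[where 'a='a, of z] by (simp add: power_n power_add CHAR_p)
  also have "\<dots> = of_int z ^ p * of_int z ^ k"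
    by (simp add: ab power_add)
  finally show ?thesis
    using of_int_power_CHAR[where 'a='a, of z] by (simp add: CHAR_p)
qed

text \<open>A nonzero sum requires \<open>p ^ 2 - 1\<close> to divide \<open>u + p * v\<close>,
  which lies strictly between 0 and \<open>2 * (p ^ 2 - 1)\<close>. Hence the two are equal.\<close>

lemma power_sum_exponent:
  assumes "u \<le> p + k" "v \<le> p + k" "0 < u"
  shows "(\<Sum>x::'a\<in>UNIV. x ^ u * (x ^ p) ^ v) = (if u = p - 1 \<and> v = p - 1 then -1 else 0)"
proof -
  have eq: "(\<Sum>x::'a\<in>UNIV. x ^ u * (x ^ p) ^ v) = (\<Sum>x\<in>UNIV. x ^ (u + p * v))"
    by (simp add: power_add power_mult)
  show ?thesis
  proof (cases "u = p - 1 \<and> v = p - 1")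
    case True
    have "u + p * v = p ^ 2 - 1"
      using True k_bound by (cases p) (auto simp: power2_eq_square algebra_simps)
    then show ?thesis
      using True finite_subfield.power_sum_card_minus_1[OF finite_subfield_UNIV[where 'a='a]]
      unfolding eq by (simp add: CARD)
  next
    case False
    have "\<not> (p ^ 2 - 1) dvd u + p * v"
    proof
      assume "p ^ 2 - 1 dvd u + p * v"
      then obtain m where m: "u + p * v = (p ^ 2 - 1) * m"
        by blast
      have "u + p * v \<le> (p + k) * (p + 1)"
        using assms mult_le_mono2[OF assms(2), of p] by (simp add: algebra_simps)
      also have "\<dots> < (2 * (p - 1)) * (p + 1)"
        using k_bound by (intro mult_strict_right_mono) auto
      also have "\<dots> = (p ^ 2 - 1) * 2"
        using k_bound by (cases p) (auto simp: power2_eq_square algebra_simps)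
      finally have "m < 2"
        using m by simp
      moreover have "m \<noteq> 0"
        using m assms(3) by (intro notI) simp
      ultimately have "m = 1"
        by simp
      then have "u + p * v = p ^ 2 - 1"
        using m by simp
      then have main: "(u + 1) + p * v = p * p"
        using k_bound by (cases p) (auto simp: power2_eq_square)
      \<comment> \<open>Modulo \<open>p\<close> this determines \<open>u + 1\<close>, and
        \<open>u + 1 < 2 * p\<close> leaves only \<open>u = p - 1\<close>.\<close>
      then have "p dvd (u + 1) + p * v"
        by simp
      then have "p dvd u + 1"
        by (rule iffD1[OF dvd_add_left_iff, rotated]) simp
      then obtain q where q: "u + 1 = p * q"
        by blast
      have "p * q < p * 2"
        using q[symmetric] assms(1) k_bound by linarith
      then have "q = 1"
        using q by (cases q) auto
      then have u: "u = p - 1"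
        using q by simp
      then have "p * (1 + v) = p * p"
        using main k_bound by simp
      then have "1 + v = p"
        using k_bound by (simp only: nat_mult_eq_cancel1)
      then have "v = p - 1"
        by simp
      then show False
        using u False by simp
    qed
    then show ?thesis
      using False finite_subfield.power_sum_eq_0[OF finite_subfield_UNIV[where 'a='a], of "u + p * v"]
      unfolding eq by (simp add: CARD)
  qed
qed

abbreviation f :: "'a \<Rightarrow> 'a" where "f x \<equiv> x ^ n"
abbreviation fp :: "'a \<Rightarrow> 'a" where "fp x \<equiv> f x ^ CHAR('a)"

text \<open>As \<open>x ^ (p * p) = x\<close>, the \<open>p\<close>-th power exchanges the digits
  \<open>a\<close> and \<open>b\<close>. In the double binomial expansion only
  \<open>a + i = b + j = p - 1\<close> survives. Since \<open>p - 1 - a = b - (k + 1)\<close> and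
  \<open>p - 1 - b = a - (k + 1)\<close>, the binomials equal \<open>b choose (k + 1)\<close> and
  \<open>a choose (k + 1)\<close>.\<close>

lemma corr_1: "corr f fp 1 = - (of_nat (b choose (p - 1 - a)) * of_nat (a choose (p - 1 - b)))"
proof -
  have fp: "fp (x + 1) = (x ^ p + 1) ^ a * (x + 1) ^ b" for x
  proof -
    have "fp (x + 1) = ((x + 1) ^ p) ^ a * ((x + 1) ^ (p * p)) ^ b"
      unfolding CHAR_p power_n by (simp add: power_mult_distrib ac_simps flip: power_mult)
    moreover have "(x + 1) ^ p = x ^ p + 1"
      using freshmans_dream[OF prime_CHAR_finite refl, of x "1::'a"] by (simp add: CHAR_p)
    ultimately show ?thesis
      by (simp only: frobenius_twice)
  qed
  have term_eq: "f x * fp (x + 1)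
      = (\<Sum>i\<le>b. \<Sum>j\<le>a. of_nat (b choose i) * of_nat (a choose j) * (x ^ (a + i) * (x ^ p) ^ (b + j)))"
    for x
  proof -
    have "f x * fp (x + 1) = x ^ a * (x ^ p) ^ b * ((\<Sum>i\<le>b. of_nat (b choose i) * x ^ i)
        * (\<Sum>j\<le>a. of_nat (a choose j) * (x ^ p) ^ j))"
      unfolding fp power_n[of x] using binomial_ring[of x 1 b] binomial_ring[of "x ^ p" 1 a] by simp
    also have "\<dots> = x ^ a * (x ^ p) ^ b * (\<Sum>i\<le>b. \<Sum>j\<le>a. of_nat (b choose i) * x ^ i
        * (of_nat (a choose j) * (x ^ p) ^ j))"
      by (simp only: sum_product)
    finally show ?thesis
      by (simp only: sum_distrib_left power_add ac_simps)
  qed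
  have "corr f fp 1 = (\<Sum>i\<le>b. \<Sum>j\<le>a. of_nat (b choose i) * of_nat (a choose j)
      * (\<Sum>x\<in>UNIV. x ^ (a + i) * (x ^ p) ^ (b + j)))"
    unfolding corr_def term_eq
    by (subst sum.swap, subst sum.swap) (simp add: sum_distrib_left)
  also have "\<dots> = (\<Sum>i\<le>b. \<Sum>j\<le>a. if i = p - 1 - a then if j = p - 1 - b
      then - (of_nat (b choose i) * of_nat (a choose j)) else 0 else 0)"
  proof (intro sum.cong[OF refl])
    fix i j assume "i \<in> {..b}" "j \<in> {..a}"
    then have "a + i \<le> p + k" "b + j \<le> p + k" "0 < a + i"
      using ab by auto
    from power_sum_exponent[OF this] ab show "of_nat (b choose i) * of_nat (a choose j)
        * (\<Sum>x\<in>UNIV. x ^ (a + i) * (x ^ p) ^ (b + j))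
      = (if i = p - 1 - a then if j = p - 1 - b
      then - (of_nat (b choose i) * of_nat (a choose j) :: 'a) else 0 else 0)"
      by auto
  qed
  also have "\<dots> = - (of_nat (b choose (p - 1 - a)) * of_nat (a choose (p - 1 - b)))"
  proof -
    have "(\<Sum>j\<le>a. if i = p - 1 - a then if j = p - 1 - b
        then - (of_nat (b choose i) * of_nat (a choose j)) else 0 else 0)
      = (if i = p - 1 - a
        then - (of_nat (b choose i) * of_nat (a choose (p - 1 - b))) else 0 :: 'a)" for i
      using ab by (cases "i = p - 1 - a") auto
    then show ?thesis
      using ab by simp
  qed
  finally show ?thesis .
qed

lemma corr_1_neq_0: "corr f fp 1 \<noteq> 0"
  unfolding corr_1 using of_nat_choose_neq_0[where 'a='a, of b "p - 1 - a"]
    of_nat_choose_neq_0[where 'a='a, of a "p - 1 - b"] ab prime_p CHAR_p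
  by simp

text \<open>For nonzero \<open>t = of_int z\<close> the substitution \<open>x = t * y\<close> pulls
  out the factor \<open>f t * fp t = t ^ (2 * k + 2)\<close>.\<close>

lemma corr_of_int: "corr f fp (of_int z) = corr f fp 1 * of_int (z ^ (2 * k + 2))"
proof (cases "of_int z = (0::'a)")
  case True
  \<comment> \<open>The correlation at 0 sums \<open>x ^ (n * (p + 1))\<close>. It vanishes because
    \<open>n\<close> is congruent to \<open>k + 1\<close> modulo \<open>p - 1\<close> and
    \<open>0 < k + 1 < p - 1\<close>.\<close>
  have "\<not> (p ^ 2 - 1) dvd n + p * n"
  proof
    assume "p ^ 2 - 1 dvd n + p * n"
    moreover have "p ^ 2 - 1 = (p - 1) * (p + 1)" "n + p * n = n * (p + 1)"
      by (cases p; simp add: power2_eq_square algebra_simps)+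
    ultimately have "p - 1 dvd n"
      by (metis add_is_0 dvd_times_right_cancel_iff one_neq_zero mult.commute)
    moreover have "n = b * (p - 1) + (p - 1) + (k + 1)"
      using ab n k_bound by (cases p) (auto simp: algebra_simps)
    ultimately have "p - 1 dvd k + 1"
      by (metis dvd_add_right_iff dvd_add_triv_right_iff dvd_triv_right)
    then show False
      using k_bound k by (auto dest: dvd_imp_le)
  qed
  then have "(\<Sum>x::'a\<in>UNIV. x ^ (n + p * n)) = 0"
    using finite_subfield.power_sum_eq_0[OF finite_subfield_UNIV[where 'a='a]] by (simp add: CARD)
  then show ?thesis
    using True by (simp add: corr_def CHAR_p power_add mult.commute flip: power_mult)
next
  case False
  define t :: 'a where "t = of_int z"
  have t: "t \<noteq> 0"
    using False by (simp add: t_def)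
  have "bij (\<lambda>y. t * y)"
    by (rule bij_betw_byWitness[where f' = "\<lambda>y. y / t"]) (use t in auto)
  then have "corr f fp t = (\<Sum>y\<in>UNIV. f (t * y) * fp (t * y + t))"
    unfolding corr_def by (rule sum.reindex_bij_betw[symmetric])
  also have "\<dots> = (\<Sum>y\<in>UNIV. (f t * fp t) * (f y * fp (y + 1)))"
  proof (rule sum.cong[OF refl])
    fix y :: 'a
    have "t * y + t = t * (y + 1)"
      by (simp add: algebra_simps)
    then show "f (t * y) * fp (t * y + t) = (f t * fp t) * (f y * fp (y + 1))"
      by (simp only: power_mult_distrib ac_simps)
  qed
  also have "\<dots> = f t * fp t * corr f fp 1"
    by (simp add: corr_def sum_distrib_left)
  also have "fp t = f t"
    unfolding t_def by (metis of_int_power of_int_power_CHAR)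
  also have "f t * f t = t ^ (2 * k + 2)"
    unfolding t_def of_int_power_n by (simp add: mult_2 flip: power_add)
  finally show ?thesis
    by (simp add: t_def)
qed

lemma not_k_PN: "\<not> k_PN k (monom (1::'a) n)"
proof
  assume PN: "k_PN k (monom (1::'a) n)"
  define D where "D = (unit_diff ^^ k) f"
  have "poly (poly_diffs k (\<lambda>_. 1) (monom 1 n)) = D"
    unfolding poly_poly_diffs_1 D_def by (simp add: poly_monom[abs_def])
  moreover have "bij (poly (poly_diffs k (\<lambda>_. 1) (monom (1::'a) n)))"
    using PN by (simp add: k_PN_def)
  ultimately have bij: "bij D"
    by simp
  have "p + 1 < p * 2"
    using k_bound by simp
  also have "p * 2 \<le> p * p - p"
    using k_bound mult_le_mono2[of 3 p p] by linarith
  also have "\<dots> \<le> p ^ 2 - 1"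
    using k_bound by (simp add: power2_eq_square)
  finally have "(\<Sum>x\<in>UNIV. D x ^ (p + 1)) = 0"
    by (intro finite_subfield.bij_power_sum[OF finite_subfield_UNIV bij]) (simp add: CARD)
  \<comment> \<open>The shift 0 is written as \<open>of_int 0\<close> to fit the central differences
    over integers.\<close>
  moreover have "(\<Sum>x\<in>UNIV. D x ^ (p + 1)) = corr D (\<lambda>x. D x ^ CHAR('a)) (of_int 0)"
    by (simp add: corr_def CHAR_p)
  moreover have "\<dots> = (-1) ^ k * (cdiff ^^ k) (\<lambda>z. corr f fp (of_int z)) 0"
    unfolding D_def unit_diff_funpow_power_CHAR[symmetric] by (rule corr_unit_diff_funpow)
  moreover have "\<dots> = (-1) ^ k * (corr f fp 1 * of_int (cdiff_power_at_0 k (2 * k + 2)))"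
    unfolding corr_of_int cdiff_funpow_scale_of_int cdiff_power_at_0_def ..
  ultimately have "of_int (cdiff_power_at_0 k (2 * k + 2)) = (0::'a)"
    using corr_1_neq_0 by simp
  then have "of_int (12 * cdiff_power_at_0 k (2 * k + 2)) = (0::'a)"
    by simp
  then have "of_nat (k * fact (2 * k + 2)) = (0::'a)"
    by (metis cdiff_power_at_0_next of_int_of_nat_eq of_nat_fact of_nat_mult)
  then have "p dvd k * fact (2 * k + 2)"
    unfolding of_nat_eq_0_iff_char_dvd CHAR_p .
  then have "p dvd k \<or> p dvd fact (2 * k + 2)"
    using prime_p by (simp only: prime_dvd_mult_iff)
  then have "p \<le> k \<or> p \<le> 2 * k + 2"
    using prime_p k by (auto simp only: prime_dvd_fact_iff dest: dvd_imp_le)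
  then show False
    using k_bound by linarith
qed

end

section \<open>Reduction of the exponent on the prime field and decision between the two digit
  sums\<close>

theorem theorem1p3:
  fixes p k n a b :: nat
  assumes "prime p"
    and "k \<ge> 1"
    and "p \<ge> 2 * k + 2"
    and "n \<le> p ^ 2 - 1"
    and "CARD('a::{field,finite}) = p ^ 2"
    and "k_PN k (monom (1::'a) n)"
    and "a \<le> p - 1" and "b \<le> p - 1" and "n = a + b * p"
  shows "a + b = k + 1"
proof -
  let ?K = "range of_int :: 'a set"
  have char: "CHAR('a) = p"
    using CHAR_eq_of_CARD assms(1,5) .
  have p: "p \<ge> 4"
    using assms(2,3) by simp
  \<comment> \<open>The exponent reduced by \<open>x ^ p = x\<close>. As
    \<open>a + b \<le> 2 * p - 2\<close>, subtracting \<open>p - 1\<close> once suffices; a positive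
    exponent stays positive, which matters at \<open>x = 0\<close>.\<close>
  define e where "e = (if a + b = 0 then 0 else if a + b < p then a + b else a + b - (p - 1))"
  have e: "e < p"
    using assms(7,8) p by (auto simp: e_def)
  have power_eq: "x ^ n = x ^ e" if x: "x \<in> ?K" for x :: 'a
  proof -
    have xp: "x ^ p = x"
      using x of_int_power_CHAR[where 'a='a] by (auto simp: char)
    have "x ^ n = x ^ a * (x ^ p) ^ b"
      by (simp add: assms(9) power_add power_mult mult.commute[of b])
    then have "x ^ n = x ^ (a + b)"
      by (simp add: xp power_add)
    moreover have "x ^ (a + b) = x ^ e"
    proof (cases "a + b < p")
      case False
      then have "a + b = p + (a + b - p)" "e = Suc (a + b - p)"
        using p by (auto simp: e_def)
      then show ?thesis
        using xp by (metis power_add power_Suc)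
    qed (auto simp: e_def)
    ultimately show ?thesis
      by simp
  qed
  have "degree (monom (1::'a) e) = k + 1"
  proof (rule k_PN_degree_on_subfield[OF finite_subfield_range_of_int _ _ assms(6,2)])
    fix x :: 'a assume x: "x \<in> ?K"
    show "poly (monom 1 n) x = poly (monom 1 e) x"
      using power_eq[OF x] by (simp add: poly_monom)
    show "poly (monom 1 e) x \<in> ?K"
      using finite_subfield.power_K[OF finite_subfield_range_of_int x, of e]
      by (simp add: poly_monom)
  qed (use assms(1) e in \<open>simp_all add: card_range_of_int char degree_monom_eq\<close>)
  then have "e = k + 1"
    by (simp add: degree_monom_eq)
  \<comment> \<open>By \<open>e = k + 1\<close>, either \<open>a + b = k + 1\<close> or
    \<open>a + b - (p - 1) = k + 1\<close>.\<close>
  moreover have "a + b \<noteq> p + k"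
  proof
    assume "a + b = p + k"
    then have "large_digit_sum TYPE('a) p k a b n"
      using assms p by unfold_locales auto
    then show False
      using large_digit_sum.not_k_PN assms(6) by blast
  qed
  ultimately show ?thesis
    using p by (auto simp: e_def split: if_splits)
qed

end
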